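(* Let $\mathcal{L}$ and $\mathcal{R}$ be arrow systems with $\mathcal{L}\preccurlyeq\mathcal{R}$, and let $L=\{L_n\}_{n\ge 0}$ and $R=\{R_n\}_{n\ge 0}$ be the sequences they determine. Then: (i) $\liminf_{n\to\infty} L_n\le \liminf_{n\to\infty} R_n$. (ii) $\limsup_{n\to\infty} L_n\le \limsup_{n\to\infty} R_n$. (iii) Let $a_n\le n$ be any increasing sequence with $a_n\to\infty$. If there exists $x\in\mathbb{Z}$ such that $R_n\ge x$ for infinitely many $n$, then $\limsup_{n\to\infty}\frac{L_n}{a_n}\le\limsup_{n\to\infty}\frac{R_n}{a_n}$. (iv) For all $t\ge 0$ and $x\in\mathbb{Z}$: if $n_{R,t}(x)>n_{L,t}(x)$ then $n_{R,t}(y)\ge n_{L,t}(y)$ for every $y>x$. (v) If $\mathcal{R}$ is $0$-right recurrent then so is $\mathcal{L}$.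
   Context: $\mathbb{N}=\{1,2,\dots\}$. An arrow system is a collection $\mathcal{E}=(\mathcal{E}(x,r))_{x\in\mathbb{Z},r\in\mathbb{N}}$ with each $\mathcal{E}(x,r)\in\{\leftarrow,\rightarrow\}$. For $j\in\mathbb{Z}$ and $r\ge 0$, $\mathcal{E}_{\leftarrow}(j,r)$ is the number of $\leftarrow$ arrows among $\mathcal{E}(j,1),\dots,\mathcal{E}(j,r)$, and $\mathcal{E}_{\rightarrow}(j,r)=r-\mathcal{E}_{\leftarrow}(j,r)$. An arrow system $\mathcal{E}$ determines a sequence $E=\{E_n\}_{n\ge 0}$ of integers: $E_0=0$ and, if $\#\{0\le m\le n: E_m=E_n\}=k$, then $E_{n+1}=E_n+1$ if $\mathcal{E}(E_n,k)=\rightarrow$ and $E_{n+1}=E_n-1$ if $\mathcal{E}(E_n,k)=\leftarrow$. For arrow systems, $\mathcal{L}\preccurlyeq\mathcal{R}$ means that $\mathcal{L}_{\leftarrow}(j,r)\ge\mathcal{R}_{\leftarrow}(j,r)$ for every $j\in\mathbb{Z}$ and $r\in\mathbb{N}$. For a sequence $E$, $t\ge 0$ and $x\in\mathbb{Z}$, $n_{E,t}(x)=\#\{0\le k\le t: E_k=x\}$. An arrow system $\mathcal{E}$ is $0$-right recurrent if, in the new system $\mathcal{E}_+$ defined by $\mathcal{E}_+(0,i)=\rightarrow$ for all $i\ge 1$ and $\mathcal{E}_+(x,i)=\mathcal{E}(x,i)$ for all $i\ge 1$ and $x>0$ (arrows at $x<0$ are irrelevant), the corresponding sequence $E_+$ satisfies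 $E_{+,n}=0$ for infinitely many $n$. *)

theory Defs
  imports Complex_Main "HOL-Library.Extended_Real"
begin

datatype arrow = LeftArrow | RightArrow

text \<open>The arrows at a site are numbered from 1; the value of an arrow system at index 0
  plays no role in any of the definitions below.\<close>

type_synonym arrow_system = "int \<Rightarrow> nat \<Rightarrow> arrow"

definition left_arrows :: "arrow_system \<Rightarrow> int \<Rightarrow> nat \<Rightarrow> nat" where
  "left_arrows \<E> j r = card {i \<in> {1..r}. \<E> j i = LeftArrow}"

definition arrow_le :: "arrow_system \<Rightarrow> arrow_system \<Rightarrow> bool" (infix "\<preceq>\<^sub>a" 50) where
  "\<L> \<preceq>\<^sub>a \<R> \<longleftrightarrow> (\<forall>j. \<forall>r\<ge>1. left_arrows \<L> j r \<ge> left_arrows \<R> j r)"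

context
  notes conj_cong [fundef_cong]
begin

fun walk :: "arrow_system \<Rightarrow> nat \<Rightarrow> int" where
  "walk \<E> 0 = 0"
| "walk \<E> (Suc n) =
     (case \<E> (walk \<E> n) (card {m. m \<le> n \<and> walk \<E> m = walk \<E> n}) of
        RightArrow \<Rightarrow> walk \<E> n + 1
      | LeftArrow \<Rightarrow> walk \<E> n - 1)"

end

definition visits :: "(nat \<Rightarrow> int) \<Rightarrow> nat \<Rightarrow> int \<Rightarrow> nat" where
  "visits E t x = card {k. k \<le> t \<and> E k = x}"

text \<open>The walk in the modified system never leaves the nonnegative integers, so the arrows at
  negative sites may be left unchanged.\<close>

definition reflect_at_zero :: "arrow_system \<Rightarrow> arrow_system" where
  "reflect_at_zero \<E> x i = (if x = 0 then RightArrow else \<E> x i)"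

definition zero_right_recurrent :: "arrow_system \<Rightarrow> bool" where
  "zero_right_recurrent \<E> \<longleftrightarrow> infinite {n. walk (reflect_at_zero \<E>) n = 0}"

end

theory Submission
  imports Defs
begin

text \<open>
  The proof compares local times of the two walks, and the comparison is made between two
  unrelated times: \<open>\<R>\<close> is stopped at time \<open>t\<close> and \<open>\<L>\<close> at an arbitrary time \<open>s\<close>.

  Suppose \<open>\<R>\<close> has just arrived at a site \<open>x\<close> and has visited it more often than \<open>\<L>\<close> has. Then \<open>\<R>\<close>
  has used at least as many arrows at \<open>x\<close> as \<open>\<L>\<close>, and because \<open>\<L> \<preceq>\<^sub>a \<R>\<close> it has jumped right from
  \<open>x\<close> at least as often. As \<open>\<R>\<close> stands at \<open>x\<close> again, it has made at least as many jumps
  back from \<open>x + 1\<close> as \<open>\<L>\<close>. Left arrows are rarer in \<open>\<R>\<close>, so this took \<open>\<R>\<close> at least as many arrows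
  at \<open>x + 1\<close> as \<open>\<L>\<close> needed up to its last left jump there. If \<open>\<L>\<close> made right jumps from \<open>x + 1\<close>
  after that, then it has not crossed the edge from \<open>x + 1\<close> to \<open>x\<close> again, and this missing crossing
  makes the comparison of left jumps strict. So \<open>\<R>\<close> has used at least as many arrows
  at \<open>x + 1\<close>, and the argument moves on to \<open>x + 2\<close>. Thus \<open>\<R>\<close> has by time \<open>t\<close> visited every
  site to the right of \<open>x\<close> at least as often as \<open>\<L>\<close> by time \<open>s\<close>. This is
  \<open>visits_le_to_the_right\<close>. Reflecting the integers exchanges the two systems, and
  \<open>visits_le_to_the_left\<close> is the mirror image.

  All claims follow from these two lemmas.

  \<^item> In the comparison of local times at a common time (\<open>visits_single_crossing\<close>), a first violation
    at a pair \<open>x < y\<close> would be created by \<open>\<R>\<close> stepping to \<open>x\<close> or by \<open>\<L>\<close> stepping to \<open>y\<close>; each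
    is excluded by one of the lemmas.

  \<^item> Suppose \<open>\<L>\<close> is eventually above a level that \<open>\<R>\<close> does not eventually exceed. Then \<open>\<R>\<close> returns
    to some site often enough, or goes down far enough, for \<open>visits_le_to_the_right\<close> to apply with one
    fixed \<open>t\<close> and all \<open>s\<close>. The \<open>t + 1\<close> visits of \<open>\<R>\<close> would then bound the infinitely many visits of
    \<open>\<L>\<close>. This is \<open>eventually_above_transfer\<close>; it yields the inequality for the lower limits, by
    reflection the one for the upper limits, and for the systems reflected at 0 the statement on
    recurrence.

  \<^item> If \<open>\<L>\<close> reached a site before \<open>\<R>\<close> had, then \<open>visits_le_to_the_left\<close> would make the total time of \<open>\<L>\<close>
    exceed that of \<open>\<R>\<close>. So at each time the running maximum of \<open>\<L>\<close> is at most that of \<open>\<R>\<close>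
    (\<open>running_maximum_le\<close>). For a monotone scale \<open>a\<close>, an upper limit of walk values divided by \<open>a\<close> that
    is not negative is controlled by running maxima, whence the rescaled inequality.
\<close>

section \<open>Counting departures\<close>

text \<open>At time \<open>t\<close> the arrow at the current site is still to be used, so the number of arrows used at a
  site is the number of visits strictly before \<open>t\<close>.\<close>

definition departures :: "arrow_system \<Rightarrow> nat \<Rightarrow> int \<Rightarrow> nat" where
  "departures \<E> t x = card {k. k < t \<and> walk \<E> k = x}"

lemma departures_0 [simp]: "departures \<E> 0 x = 0"
  by (simp add: departures_def)

lemma visits_eq_departures:
  "visits (walk \<E>) t x = departures \<E> t x + (if walk \<E> t = x then 1 else 0)"
proof (cases "walk \<E> t = x")
  case True
  then have "{k. k \<le> t \<and> walk \<E> k = x} = insert t {k. k < t \<and> walk \<E> k = x}" by auto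
  with True show ?thesis by (simp add: visits_def departures_def)
next
  case False
  then have "{k. k \<le> t \<and> walk \<E> k = x} = {k. k < t \<and> walk \<E> k = x}"
    using order_le_less by blast
  with False show ?thesis by (simp add: visits_def departures_def)
qed

lemma departures_Suc:
  "departures \<E> (Suc t) x = departures \<E> t x + (if walk \<E> t = x then 1 else 0)"
  using visits_eq_departures[of \<E> t x] by (simp add: visits_def departures_def less_Suc_eq_le)

lemma walk_Suc_arrow:
  "walk \<E> (Suc t) =
     (if \<E> (walk \<E> t) (Suc (departures \<E> t (walk \<E> t))) = RightArrow
      then walk \<E> t + 1 else walk \<E> t - 1)"
  using visits_eq_departures[of \<E> t "walk \<E> t"]
  by (auto simp: visits_def split: arrow.split)

declare walk.simps(2) [simp del]

lemma left_arrows_0 [simp]: "left_arrows \<E> x 0 = 0"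
  by (simp add: left_arrows_def)

lemma left_arrows_Suc:
  "left_arrows \<E> x (Suc r) = left_arrows \<E> x r + (if \<E> x (Suc r) = LeftArrow then 1 else 0)"
proof -
  have "{i \<in> {1..Suc r}. \<E> x i = LeftArrow} =
      {i \<in> {1..r}. \<E> x i = LeftArrow} \<union> (if \<E> x (Suc r) = LeftArrow then {Suc r} else {})"
    by (auto simp: le_Suc_eq)
  then show ?thesis
    by (auto simp: left_arrows_def card_insert_if)
qed

lemma left_arrows_mono: "r \<le> s \<Longrightarrow> left_arrows \<E> x r \<le> left_arrows \<E> x s"
  by (induction s rule: dec_induct) (auto simp: left_arrows_Suc)

lemma left_arrows_growth: "r \<le> s \<Longrightarrow> left_arrows \<E> x s \<le> left_arrows \<E> x r + (s - r)"
  by (induction s rule: dec_induct) (auto simp: left_arrows_Suc Suc_diff_le)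

lemma arrow_leD: "\<L> \<preceq>\<^sub>a \<R> \<Longrightarrow> left_arrows \<R> x r \<le> left_arrows \<L> x r"
  by (cases "r = 0") (auto simp: arrow_le_def)

text \<open>Each crossing of the edge between \<open>x\<close> and \<open>x + 1\<close> consumes an arrow at one of its ends, and
  crossings alternate in direction. Hence their balance depends only on the sides of the edge on
  which the walk starts and currently stands.\<close>

lemma edge_crossing_balance:
  "int (departures \<E> t x) - int (left_arrows \<E> x (departures \<E> t x))
     - int (left_arrows \<E> (x + 1) (departures \<E> t (x + 1)))
   = (if walk \<E> t > x then 1 else 0) - (if 0 > x then 1 else 0)"
proof (induction t)
  case 0
  show ?case by simp
next
  case (Suc t)
  consider "walk \<E> t = x" | "walk \<E> t = x + 1" | "walk \<E> t \<noteq> x" "walk \<E> t \<noteq> x + 1" by blast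
  then show ?case
  proof cases
    case 1
    with Suc show ?thesis
      by (cases "\<E> x (Suc (departures \<E> t x))")
        (auto simp: departures_Suc walk_Suc_arrow left_arrows_Suc)
  next
    case 2
    with Suc show ?thesis
      by (cases "\<E> (x + 1) (Suc (departures \<E> t (x + 1)))")
        (auto simp: departures_Suc walk_Suc_arrow left_arrows_Suc)
  next
    case 3
    then have "walk \<E> (Suc t) > x \<longleftrightarrow> walk \<E> t > x" by (auto simp: walk_Suc_arrow)
    with 3 Suc show ?thesis by (simp add: departures_Suc)
  qed
qed

text \<open>The last departure from \<open>x\<close> decides on which side of \<open>x\<close> the walk is afterwards, since a
  nearest-neighbour walk cannot change sides without visiting \<open>x\<close>.\<close>

lemma last_arrow_left:
  assumes "walk \<E> t < x" and "0 < departures \<E> t x"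
  shows "\<E> x (departures \<E> t x) = LeftArrow"
  using assms
proof (induction t)
  case 0
  then show ?case by simp
next
  case (Suc t)
  show ?case
  proof (cases "walk \<E> t = x")
    case True
    with Suc.prems(1) show ?thesis
      by (cases "\<E> x (Suc (departures \<E> t x))") (auto simp: departures_Suc walk_Suc_arrow)
  next
    case False
    with Suc.prems(1) have "walk \<E> t < x" by (auto simp: walk_Suc_arrow split: if_splits)
    with Suc False show ?thesis by (simp add: departures_Suc)
  qed
qed

section \<open>Propagation of local time comparisons\<close>

text \<open>Equal arrow counts favour \<open>\<R>\<close> in jumps to the right from \<open>x\<close>, and \<open>\<R>\<close> being at or left of \<open>x\<close>
  means that as many of these jumps as possible have been undone. So \<open>\<R>\<close> has used at least as many
  left arrows at \<open>x + 1\<close> as \<open>\<L>\<close>, and strictly more if \<open>\<L>\<close> is right of \<open>x\<close>. In the strict case more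
  arrows were needed in total; otherwise the last arrow that \<open>\<L>\<close> used at \<open>x + 1\<close> is a left one, and \<open>\<R>\<close>
  needed at least as many arrows to get as many left ones. Bounding the visits of
  \<open>\<L>\<close>, and not only its departures, records the extra visit when \<open>\<L>\<close> stands at \<open>x + 1\<close>.\<close>

lemma visits_le_departures_next:
  assumes le: "\<L> \<preceq>\<^sub>a \<R>" and pos: "walk \<R> t \<le> x"
    and dep: "departures \<L> s x \<le> departures \<R> t x"
  shows "visits (walk \<L>) s (x + 1) \<le> departures \<R> t (x + 1)"
proof (rule ccontr)
  define k l where "k = departures \<R> t (x + 1)" and "l = departures \<L> s (x + 1)"
  assume "\<not> ?thesis"
  then have less: "k < l + (if walk \<L> s = x + 1 then 1 else 0)"
    by (simp add: visits_eq_departures k_def l_def)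
  have "left_arrows \<R> x (departures \<R> t x)
      \<le> left_arrows \<L> x (departures \<L> s x) + (departures \<R> t x - departures \<L> s x)"
    using left_arrows_growth[OF dep, of \<R> x] arrow_leD[OF le, of x "departures \<L> s x"] by linarith
  then have enough: "left_arrows \<L> (x + 1) l + (if walk \<L> s > x then 1 else 0)
      \<le> left_arrows \<R> (x + 1) k"
    using edge_crossing_balance[of \<R> t x] edge_crossing_balance[of \<L> s x] pos dep
    unfolding k_def l_def by (auto split: if_splits)
  show False
  proof (cases "walk \<L> s > x")
    case True
    have "k \<le> l" using less by (auto split: if_splits)
    then have "left_arrows \<R> (x + 1) k \<le> left_arrows \<L> (x + 1) l"
      using left_arrows_mono[of k l \<R> "x + 1"] arrow_leD[OF le, of "x + 1" l] by linarith
    with enough True show False by simp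
  next
    case False
    \<comment> \<open>\<open>\<L>\<close> stands left of \<open>x + 1\<close>, so its most recent arrow there is a left one, and removing it
       leaves at least \<open>k\<close> arrows with strictly fewer left ones.\<close>
    with less have "k < l" by simp
    with False have "\<L> (x + 1) l = LeftArrow"
      unfolding l_def by (intro last_arrow_left) auto
    moreover obtain l' where l': "l = Suc l'" "k \<le> l'" using \<open>k < l\<close> by (cases l) auto
    ultimately have "left_arrows \<L> (x + 1) l = left_arrows \<L> (x + 1) l' + 1"
      by (simp add: left_arrows_Suc)
    with enough left_arrows_mono[OF l'(2), of \<R> "x + 1"] arrow_leD[OF le, of "x + 1" l']
    show False by linarith
  qed
qed

text \<open>Keeping \<open>s\<close> and \<open>t\<close> unrelated is what makes limits accessible: if \<open>\<R>\<close> is stopped at a site that it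
  has visited more often than \<open>\<L>\<close> ever will, its finitely many visits bound those of \<open>\<L>\<close> to the right
  of this site for all time. The strict inequality
  is what survives of the comparison when the current, unfinished visit of \<open>\<R>\<close> is discarded.\<close>

lemma visits_le_to_the_right:
  assumes le: "\<L> \<preceq>\<^sub>a \<R>" and less: "visits (walk \<L>) s (walk \<R> t) < visits (walk \<R>) t (walk \<R> t)"
    and y: "walk \<R> t \<le> y"
  shows "visits (walk \<L>) s y \<le> visits (walk \<R>) t y"
proof -
  have base: "visits (walk \<L>) s (walk \<R> t) \<le> departures \<R> t (walk \<R> t)"
    using less by (simp add: visits_eq_departures[of \<R>])
  have "visits (walk \<L>) s y \<le> departures \<R> t y"
    using y
  proof (induction y rule: int_ge_induct)
    case base
    show ?case by (fact \<open>visits (walk \<L>) s (walk \<R> t) \<le> departures \<R> t (walk \<R> t)\<close>)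
  next
    case (step y)
    then have "departures \<L> s y \<le> departures \<R> t y"
      by (simp add: visits_eq_departures)
    with le step.hyps show ?case by (rule visits_le_departures_next)
  qed
  then show ?thesis by (simp add: visits_eq_departures[of \<R>])
qed

section \<open>Mirror symmetry\<close>

definition mirror :: "arrow_system \<Rightarrow> arrow_system" where
  "mirror \<E> x i = (case \<E> (- x) i of LeftArrow \<Rightarrow> RightArrow | RightArrow \<Rightarrow> LeftArrow)"

lemma mirror_eq_RightArrow: "mirror \<E> x i = RightArrow \<longleftrightarrow> \<E> (- x) i \<noteq> RightArrow"
  by (cases "\<E> (- x) i") (auto simp: mirror_def)

lemma walk_mirror: "walk (mirror \<E>) n = - walk \<E> n"
proof (induction n rule: less_induct)
  case (less n)
  show ?case
  proof (cases n)
    case 0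
    then show ?thesis by simp
  next
    case (Suc m)
    have "departures (mirror \<E>) m (- x) = departures \<E> m x" for x
      unfolding departures_def using less Suc by (intro arg_cong[where f = card]) auto
    moreover have "walk (mirror \<E>) m = - walk \<E> m" using less Suc by simp
    ultimately show ?thesis
      by (simp add: Suc walk_Suc_arrow mirror_eq_RightArrow)
  qed
qed

lemma visits_mirror: "visits (walk (mirror \<E>)) t x = visits (walk \<E>) t (- x)"
  by (auto simp: visits_def walk_mirror intro!: arg_cong[where f = card])

lemma left_arrows_mirror: "left_arrows (mirror \<E>) x r + left_arrows \<E> (- x) r = r"
  by (induction r) (auto simp: left_arrows_Suc mirror_def split: arrow.splits)

lemma arrow_le_mirror:
  assumes "\<L> \<preceq>\<^sub>a \<R>"
  shows "mirror \<R> \<preceq>\<^sub>a mirror \<L>"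
  unfolding arrow_le_def
proof (intro allI impI)
  fix j and r :: nat
  show "left_arrows (mirror \<L>) j r \<le> left_arrows (mirror \<R>) j r"
    using arrow_leD[OF assms, of "- j" r] left_arrows_mirror[of \<L> j r] left_arrows_mirror[of \<R> j r]
    by linarith
qed

lemma visits_le_to_the_left:
  assumes "\<L> \<preceq>\<^sub>a \<R>" and "visits (walk \<R>) t (walk \<L> s) < visits (walk \<L>) s (walk \<L> s)"
    and "y \<le> walk \<L> s"
  shows "visits (walk \<R>) t y \<le> visits (walk \<L>) s y"
  using visits_le_to_the_right[OF arrow_le_mirror[OF assms(1)], of t s "- y"] assms(2,3)
  by (simp add: visits_mirror walk_mirror)

section \<open>Consequences for the walks\<close>

text \<open>A violation at \<open>x < y\<close> cannot appear at a time when \<open>\<R>\<close> is at \<open>x\<close> or \<open>\<L>\<close> is at \<open>y\<close>, and at any other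
  time it must have been present one step earlier.\<close>

lemma visits_single_crossing:
  assumes "\<L> \<preceq>\<^sub>a \<R>" and "visits (walk \<L>) t x < visits (walk \<R>) t x" and "x < y"
  shows "visits (walk \<L>) t y \<le> visits (walk \<R>) t y"
  using assms(2)
proof (induction t)
  case 0
  then show ?case by (auto simp: visits_eq_departures split: if_splits)
next
  case (Suc t)
  have visits_Suc: "visits E (Suc t) z = visits E t z + (if E (Suc t) = z then 1 else 0)" for E z
  proof -
    have "{k. k \<le> Suc t \<and> E k = z} = {k. k \<le> t \<and> E k = z} \<union> (if E (Suc t) = z then {Suc t} else {})"
      by (auto simp: le_Suc_eq)
    then show ?thesis by (auto simp: visits_def card_insert_if)
  qed
  show ?case
  proof (rule ccontr)
    assume neg: "\<not> ?case"
    have "walk \<R> (Suc t) \<noteq> x"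
      using visits_le_to_the_right[OF assms(1), of "Suc t" "Suc t" y] Suc.prems neg \<open>x < y\<close> by auto
    moreover have "walk \<L> (Suc t) \<noteq> y"
      using visits_le_to_the_left[OF assms(1), of "Suc t" "Suc t" x] Suc.prems neg \<open>x < y\<close> by auto
    ultimately show False
      using Suc neg by (auto simp: visits_Suc split: if_splits)
  qed
qed

lemma card_times_le_if_visits_le:
  assumes "\<And>y. y \<in> Y \<Longrightarrow> visits E s y \<le> visits F t y"
  shows "card {k. k \<le> s \<and> E k \<in> Y} \<le> card {k. k \<le> t \<and> F k \<in> Y}"
proof -
  define Z where "Z = Y \<inter> E ` {..s}"
  have fin: "finite Z" by (simp add: Z_def)
  have "card {k. k \<le> s \<and> E k \<in> Y} = card (\<Union>y\<in>Z. {k. k \<le> s \<and> E k = y})"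
    by (rule arg_cong[where f = card]) (auto simp: Z_def)
  also have "\<dots> = (\<Sum>y\<in>Z. visits E s y)"
    unfolding visits_def using fin by (intro card_UN_disjoint) auto
  also have "\<dots> \<le> (\<Sum>y\<in>Z. visits F t y)"
    by (intro sum_mono assms) (simp add: Z_def)
  also have "\<dots> = card (\<Union>y\<in>Z. {k. k \<le> t \<and> F k = y})"
    unfolding visits_def using fin by (intro card_UN_disjoint[symmetric]) auto
  also have "\<dots> \<le> card {k. k \<le> t \<and> F k \<in> Y}"
    by (intro card_mono) (auto simp: Z_def)
  finally show ?thesis .
qed

text \<open>If \<open>\<L>\<close> is at a site \<open>y\<close> which \<open>\<R>\<close> has not reached, then \<open>\<L>\<close> has spent as much time left of \<open>y\<close> as
  \<open>\<R>\<close>, hence all of its time, although it is at \<open>y\<close>.\<close>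

lemma running_maximum_le:
  assumes "\<L> \<preceq>\<^sub>a \<R>"
  shows "\<exists>k\<le>n. walk \<L> n \<le> walk \<R> k"
proof (rule ccontr)
  assume "\<not> ?thesis"
  then have below: "walk \<R> k < walk \<L> n" if "k \<le> n" for k
    using that by (metis not_le)
  then have "{k. k \<le> n \<and> walk \<R> k = walk \<L> n} = {}" by fastforce
  then have "visits (walk \<R>) n (walk \<L> n) < visits (walk \<L>) n (walk \<L> n)"
    by (simp only: visits_def card.empty) (auto simp: card_gt_0_iff)
  then have "visits (walk \<R>) n y \<le> visits (walk \<L>) n y" if "y \<in> {..<walk \<L> n}" for y
    using visits_le_to_the_left[OF assms] that by auto
  then have "card {k. k \<le> n \<and> walk \<R> k \<in> {..<walk \<L> n}}
      \<le> card {k. k \<le> n \<and> walk \<L> k \<in> {..<walk \<L> n}}"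
    by (rule card_times_le_if_visits_le)
  also have "\<dots> \<le> card {..<n}"
    by (intro card_mono) (auto simp: le_less)
  also have "{k. k \<le> n \<and> walk \<R> k \<in> {..<walk \<L> n}} = {..n}"
    using below by auto
  finally show False by simp
qed

lemma walk_lower_bound: "- int n \<le> walk \<E> n"
  by (induction n) (auto simp: walk_Suc_arrow)

lemma visits_unbounded:
  assumes "infinite {n. E n = x}"
  shows "\<exists>t. E t = x \<and> N < visits E t x"
proof -
  obtain B where B: "B \<subseteq> {n. E n = x}" "finite B" "card B = Suc N"
    using infinite_arbitrarily_large[OF assms] by blast
  then have "B \<noteq> {}" by auto
  then have "E (Max B) = x" using Max_in[OF B(2)] B(1) by auto
  moreover have "card B \<le> visits E (Max B) x"
    unfolding visits_def using B by (intro card_mono) auto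
  ultimately show ?thesis using B(3) by auto
qed

lemma eventually_sequentially_iff_finite: "eventually P sequentially \<longleftrightarrow> finite {n. \<not> P n}"
  unfolding cofinite_eq_sequentially[symmetric] by (rule eventually_cofinite)

text \<open>Otherwise there is a time \<open>t\<close> at which \<open>\<R>\<close> stands at a site at most \<open>m\<close> that it has visited more often
  than \<open>\<L>\<close> ever will: \<open>\<R>\<close> either visits some site at most \<open>m\<close> infinitely often, while \<open>\<L>\<close> does so only
  finitely often, or it goes below the minimum of \<open>\<L>\<close>. The visits of \<open>\<L>\<close> above \<open>m\<close>, of which there
  are infinitely many, are then bounded in number by \<open>t + 1\<close>.\<close>

lemma eventually_above_transfer:
  assumes le: "\<L> \<preceq>\<^sub>a \<R>" and ev: "eventually (\<lambda>n. m < walk \<L> n) sequentially"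
  shows "eventually (\<lambda>n. m < walk \<R> n) sequentially"
proof (rule ccontr)
  assume "\<not> ?thesis"
  then have inf: "infinite {n. walk \<R> n \<le> m}"
    by (simp add: eventually_sequentially_iff_finite not_less)
  obtain N where N: "\<And>n. n \<ge> N \<Longrightarrow> m < walk \<L> n"
    using ev by (auto simp: eventually_sequentially)
  have "\<exists>t. walk \<R> t \<le> m \<and> (\<forall>s. visits (walk \<L>) s (walk \<R> t) < visits (walk \<R>) t (walk \<R> t))"
  proof (cases "\<exists>x\<le>m. infinite {n. walk \<R> n = x}")
    case True
    then obtain x where x: "x \<le> m" "infinite {n. walk \<R> n = x}" by blast
    obtain t where t: "walk \<R> t = x" "N < visits (walk \<R>) t x"
      using visits_unbounded[OF x(2)] by blast
    have "visits (walk \<L>) s x \<le> N" for s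
    proof -
      have "{k. k \<le> s \<and> walk \<L> k = x} \<subseteq> {..<N}"
        using N x(1) by (auto simp: not_less[symmetric])
      then have "visits (walk \<L>) s x \<le> card {..<N}"
        unfolding visits_def by (intro card_mono) auto
      then show ?thesis by simp
    qed
    with t x(1) show ?thesis using le_less_trans by blast
  next
    case False
    define b where "b = min m (- int N)"
    have "{n. b \<le> walk \<R> n \<and> walk \<R> n \<le> m} = (\<Union>x\<in>{b..m}. {n. walk \<R> n = x})" by auto
    then have "finite {n. b \<le> walk \<R> n \<and> walk \<R> n \<le> m}" using False by simp
    moreover have "{n. walk \<R> n \<le> m} \<subseteq> {n. b \<le> walk \<R> n \<and> walk \<R> n \<le> m} \<union> {n. walk \<R> n < b}"
      by auto
    ultimately have "{n. walk \<R> n < b} \<noteq> {}"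
      using inf finite_subset by fastforce
    then obtain t where t: "walk \<R> t < b" by auto
    have "b \<le> walk \<L> k" for k
      using N[of k] walk_lower_bound[of k \<L>] by (cases "k < N") (auto simp: b_def)
    with t have "walk \<L> k \<noteq> walk \<R> t" for k by (metis not_less)
    then have "visits (walk \<L>) s (walk \<R> t) = 0" for s by (simp add: visits_def)
    moreover have "0 < visits (walk \<R>) t (walk \<R> t)" by (simp add: visits_eq_departures)
    moreover have "walk \<R> t \<le> m" using t by (simp add: b_def)
    ultimately show ?thesis by metis
  qed
  then obtain t where t: "walk \<R> t \<le> m"
    "\<And>s. visits (walk \<L>) s (walk \<R> t) < visits (walk \<R>) t (walk \<R> t)" by blast
  \<comment> \<open>From time \<open>N\<close> on, \<open>\<L>\<close> stays to the right of \<open>walk \<R> t\<close>. This \<open>s\<close> gives it \<open>t + 2\<close> such times,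
     one more than \<open>\<R>\<close> has altogether up to time \<open>t\<close>.\<close>
  define s where "s = N + t + 1"
  have "card {k. k \<le> s \<and> walk \<L> k \<in> {walk \<R> t..}} \<le> card {k. k \<le> t \<and> walk \<R> k \<in> {walk \<R> t..}}"
    using visits_le_to_the_right[OF le t(2)] by (intro card_times_le_if_visits_le) auto
  also have "\<dots> \<le> card {..t}" by (intro card_mono) auto
  finally have "card {k. k \<le> s \<and> walk \<L> k \<in> {walk \<R> t..}} \<le> t + 1" by simp
  moreover have "walk \<R> t \<le> walk \<L> k" if "N \<le> k" for k using N[OF that] t(1) by linarith
  then have "card {N..s} \<le> card {k. k \<le> s \<and> walk \<L> k \<in> {walk \<R> t..}}"
    by (intro card_mono) auto
  ultimately show False by (simp add: s_def)
qed

lemma eventually_below_transfer: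
  assumes "\<L> \<preceq>\<^sub>a \<R>" and "eventually (\<lambda>n. walk \<R> n < m) sequentially"
  shows "eventually (\<lambda>n. walk \<L> n < m) sequentially"
  using eventually_above_transfer[OF arrow_le_mirror[OF assms(1)], of "- m"] assms(2)
  by (simp add: walk_mirror)

lemma liminf_walk_mono:
  assumes "\<L> \<preceq>\<^sub>a \<R>"
  shows "liminf (\<lambda>n. ereal (real_of_int (walk \<L> n))) \<le> liminf (\<lambda>n. ereal (real_of_int (walk \<R> n)))"
proof (rule ccontr)
  assume "\<not> ?thesis"
  then obtain c where c: "liminf (\<lambda>n. ereal (real_of_int (walk \<R> n))) < ereal c"
    "ereal c < liminf (\<lambda>n. ereal (real_of_int (walk \<L> n)))"
    using ereal_dense2 by (meson not_le)
  have "eventually (\<lambda>n. c < real_of_int (walk \<L> n)) sequentially"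
    using less_LiminfD[OF c(2)] by simp
  then have "eventually (\<lambda>n. \<lfloor>c\<rfloor> < walk \<R> n) sequentially"
    using eventually_above_transfer[OF assms, of "\<lfloor>c\<rfloor>"] by (simp add: floor_less_iff)
  then have "eventually (\<lambda>n. ereal c \<le> ereal (real_of_int (walk \<R> n))) sequentially"
    by eventually_elim (simp add: floor_less_iff)
  then have "ereal c \<le> liminf (\<lambda>n. ereal (real_of_int (walk \<R> n)))"
    by (rule Liminf_bounded)
  with c(1) show False by simp
qed

lemma limsup_walk_mono:
  assumes "\<L> \<preceq>\<^sub>a \<R>"
  shows "limsup (\<lambda>n. ereal (real_of_int (walk \<L> n))) \<le> limsup (\<lambda>n. ereal (real_of_int (walk \<R> n)))"
proof -
  have "liminf (\<lambda>n. ereal (real_of_int (walk (mirror \<E>) n)))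
      = - limsup (\<lambda>n. ereal (real_of_int (walk \<E> n)))" for \<E>
    using ereal_Liminf_uminus[of sequentially "\<lambda>n. ereal (real_of_int (walk \<E> n))"]
    by (simp add: walk_mirror)
  then show ?thesis
    using liminf_walk_mono[OF arrow_le_mirror[OF assms]] by simp
qed

lemma limsup_nonneg_if_frequently_ge:
  fixes r :: "nat \<Rightarrow> int" and a :: "nat \<Rightarrow> real"
  assumes "filterlim a at_top sequentially" and "infinite {n. x \<le> r n}"
  shows "0 \<le> limsup (\<lambda>n. ereal (real_of_int (r n) / a n))"
proof (rule ccontr)
  assume "\<not> ?thesis"
  then obtain c where c: "limsup (\<lambda>n. ereal (real_of_int (r n) / a n)) < ereal c" "ereal c < 0"
    using ereal_dense2 by (meson not_le)
  have "eventually (\<lambda>n. real_of_int (r n) / a n < c) sequentially"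
    using Limsup_lessD[OF c(1)] by simp
  moreover have "eventually (\<lambda>n. max 1 (real_of_int x / c) < a n) sequentially"
    using assms(1) unfolding filterlim_at_top_dense by blast
  ultimately have "eventually (\<lambda>n. \<not> x \<le> r n) sequentially"
  proof eventually_elim
    case (elim n)
    have "real_of_int (r n) < c * a n" using elim by (simp add: divide_less_eq)
    moreover have "c * a n < real_of_int x"
      using elim c(2) by (simp add: divide_less_eq mult.commute)
    ultimately show ?case by linarith
  qed
  with assms(2) show False
    by (simp add: eventually_sequentially_iff_finite)
qed

text \<open>Compare with a level \<open>c\<close> between the two upper limits. It is positive because \<open>\<R>\<close> is frequently
  bounded below, so \<open>c * a n\<close> increases to infinity and eventually dominates the whole past of \<open>\<R>\<close>, not
  only its value at \<open>n\<close>; hence it dominates the running maximum of \<open>\<R>\<close>, and with it \<open>\<L>\<close>.\<close>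

lemma limsup_scaled_walk_mono:
  fixes a :: "nat \<Rightarrow> real"
  assumes le: "\<L> \<preceq>\<^sub>a \<R>" and a: "incseq a" "filterlim a at_top sequentially"
    and freq: "infinite {n. x \<le> walk \<R> n}"
  shows "limsup (\<lambda>n. ereal (real_of_int (walk \<L> n) / a n))
     \<le> limsup (\<lambda>n. ereal (real_of_int (walk \<R> n) / a n))"
proof (rule ccontr)
  assume "\<not> ?thesis"
  then obtain c where c: "limsup (\<lambda>n. ereal (real_of_int (walk \<R> n) / a n)) < ereal c"
    "ereal c < limsup (\<lambda>n. ereal (real_of_int (walk \<L> n) / a n))"
    using ereal_dense2 by (meson not_le)
  have "0 < c"
    using limsup_nonneg_if_frequently_ge[OF a(2) freq] c(1) by (metis ereal_less(2) le_less_trans)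
  have "eventually (\<lambda>n. real_of_int (walk \<R> n) / a n < c \<and> 0 < a n) sequentially"
    using Limsup_lessD[OF c(1)] a(2) by (simp add: filterlim_at_top_dense eventually_conj)
  then obtain K where K: "\<And>n. K \<le> n \<Longrightarrow> real_of_int (walk \<R> n) / a n < c \<and> 0 < a n"
    by (auto simp: eventually_sequentially)
  define M where "M = Max ((\<lambda>k. real_of_int (walk \<R> k)) ` {..K})"
  have "eventually (\<lambda>n. M / c < a n) sequentially"
    using a(2) by (simp add: filterlim_at_top_dense)
  moreover have "eventually (\<lambda>n. K \<le> n) sequentially" by (rule eventually_ge_at_top)
  ultimately have "eventually (\<lambda>n. real_of_int (walk \<L> n) / a n \<le> c) sequentially"
  proof eventually_elim
    case (elim n)
    have "real_of_int (walk \<R> k) \<le> c * a n" if "k \<le> n" for k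
    proof (cases "k \<le> K")
      case True
      then have "real_of_int (walk \<R> k) \<le> M" by (simp add: M_def)
      with elim(1) \<open>0 < c\<close> show ?thesis by (simp add: divide_less_eq mult.commute)
    next
      case False
      then have "real_of_int (walk \<R> k) < c * a k" using K[of k] by (simp add: divide_less_eq)
      also have "c * a k \<le> c * a n" using a(1) that \<open>0 < c\<close> by (simp add: incseqD)
      finally show ?thesis by simp
    qed
    then have "real_of_int (walk \<L> n) \<le> c * a n"
      using running_maximum_le[OF le, of n] by force
    then show ?case using K[OF elim(2)] by (simp add: divide_le_eq)
  qed
  then have "limsup (\<lambda>n. ereal (real_of_int (walk \<L> n) / a n)) \<le> ereal c"
    by (intro Limsup_bounded) simp
  with c(2) show False by simp
qed

lemma arrow_le_reflect_at_zero:
  assumes "\<L> \<preceq>\<^sub>a \<R>"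
  shows "reflect_at_zero \<L> \<preceq>\<^sub>a reflect_at_zero \<R>"
proof -
  have "left_arrows (reflect_at_zero \<E>) j r = (if j = 0 then 0 else left_arrows \<E> j r)" for \<E> j r
    by (simp add: left_arrows_def reflect_at_zero_def)
  with assms show ?thesis by (simp add: arrow_le_def)
qed

lemma walk_reflect_at_zero_nonneg: "0 \<le> walk (reflect_at_zero \<E>) n"
proof (induction n)
  case (Suc n)
  then show ?case
    by (cases "walk (reflect_at_zero \<E>) n = 0") (auto simp: walk_Suc_arrow reflect_at_zero_def)
qed simp

text \<open>The reflected walks live on the nonnegative integers, so failing to return to 0 infinitely often
  means being eventually above 0, a property that passes from \<open>\<L>\<close> to \<open>\<R>\<close>.\<close>

lemma zero_right_recurrent_antimono:
  assumes "\<L> \<preceq>\<^sub>a \<R>" and "zero_right_recurrent \<R>"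
  shows "zero_right_recurrent \<L>"
proof -
  have transient_iff: "\<not> zero_right_recurrent \<E> \<longleftrightarrow>
      eventually (\<lambda>n. 0 < walk (reflect_at_zero \<E>) n) sequentially" for \<E>
  proof -
    have "\<not> 0 < walk (reflect_at_zero \<E>) n \<longleftrightarrow> walk (reflect_at_zero \<E>) n = 0" for n
      using walk_reflect_at_zero_nonneg[of \<E> n] by linarith
    then show ?thesis
      by (simp only: zero_right_recurrent_def eventually_sequentially_iff_finite not_not)
  qed
  show ?thesis
    using eventually_above_transfer[OF arrow_le_reflect_at_zero[OF assms(1)], of 0] assms(2)
      transient_iff by blast
qed

theorem theorem1p3:
  fixes \<L> \<R> :: arrow_system and L R :: "nat \<Rightarrow> int"
  assumes "\<L> \<preceq>\<^sub>a \<R>"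
    and "L = walk \<L>" and "R = walk \<R>"
  shows
    "liminf (\<lambda>n. ereal (real_of_int (L n))) \<le> liminf (\<lambda>n. ereal (real_of_int (R n))) \<and>
     limsup (\<lambda>n. ereal (real_of_int (L n))) \<le> limsup (\<lambda>n. ereal (real_of_int (R n))) \<and>
     (\<forall>a :: nat \<Rightarrow> real.
        (\<forall>n. a n \<le> real n) \<longrightarrow> incseq a \<longrightarrow> filterlim a at_top sequentially \<longrightarrow>
        (\<exists>x :: int. infinite {n. R n \<ge> x}) \<longrightarrow>
        limsup (\<lambda>n. ereal (real_of_int (L n) / a n))
          \<le> limsup (\<lambda>n. ereal (real_of_int (R n) / a n))) \<and>
     (\<forall>(t :: nat) (x :: int).
        visits R t x > visits L t x \<longrightarrow> (\<forall>y > x. visits R t y \<ge> visits L t y)) \<and>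
     (zero_right_recurrent \<R> \<longrightarrow> zero_right_recurrent \<L>)"
  unfolding assms(2,3)
  using liminf_walk_mono[OF assms(1)] limsup_walk_mono[OF assms(1)]
    limsup_scaled_walk_mono[OF assms(1)] visits_single_crossing[OF assms(1)]
    zero_right_recurrent_antimono[OF assms(1)]
  by blast

end
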